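(* Let $n\ge 2$ and let $P=(p_{abcd})\in SOT_{2,n}\subseteq(\mathbb R^n)^{\otimes 4}$ be a symmetrically odeco tensor train of length 2. Then all polynomials in $\mathcal P_n$ and $\mathcal Q_n$ vanish at $P$. That is: (1) for all $a,b,c,d\in\{1,\ldots,n\}$, every permutation $\sigma_1$ of $\{a,b\}$ and every permutation $\sigma_2$ of $\{c,d\}$, $$p_{abcd}-p_{\sigma_1(a)\sigma_1(b)\sigma_2(c)\sigma_2(d)}=0;$$ (2) for all $a,b,c,d,e,f\in\{1,\ldots,n\}$, $$\sum_{t=1}^n \left(p_{abet}\,p_{cdft}-p_{abft}\,p_{cdet}\right)=0\quad\text{and}\quad \sum_{t=1}^n \left(p_{etab}\,p_{ftcd}-p_{ftab}\,p_{etcd}\right)=0.$$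
   Context: A symmetric tensor $T\in S^3(\mathbb R^n)$ (an $n\times n\times n$ real tensor whose entries are invariant under permuting the three indices) is called symmetrically odeco if $T=\sum_{i=1}^r\lambda_i v_i^{\otimes 3}$ for some orthonormal vectors $v_1,\ldots,v_r\in\mathbb R^n$ and scalars $\lambda_i\in\mathbb R$. $SOT_{2,n}$ denotes the set of symmetrically odeco tensor trains of length 2, i.e. the set of tensors $P=(p_{abcd})_{a,b,c,d=1}^n\in(\mathbb R^n)^{\otimes 4}$ for which there are symmetrically odeco tensors $T,S\in S^3(\mathbb R^n)$ with $p_{abcd}=\sum_{s=1}^n T_{abs}S_{scd}$ for all $a,b,c,d$. $\mathcal P_n$ is the set of polynomials $p_{abcd}-p_{\sigma_1(a)\sigma_1(b)\sigma_2(c)\sigma_2(d)}$ with $a,b,c,d\in\{1,\dots,n\}$, $\sigma_1$ a permutation of $\{a,b\}$ and $\sigma_2$ a permutation of $\{c,d\}$. $\mathcal Q_n$ is the set of polynomials $\sum_{t=1}^n (p_{abet}p_{cdft}-p_{abft}p_{cdet})$ and $\sum_{t=1}^n (p_{etab}p_{ftcd}-p_{ftab}p_{etcd})$ with $a,b,c,d,e,f\in\{1,\dots,n\}$. *)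

theory Defs
  imports "HOL-Analysis.Finite_Cartesian_Product" "HOL-Analysis.Cartesian_Euclidean_Space"
    "HOL-Combinatorics.Permutations"
begin

text \<open>
  A tensor in $(R^n)^{\otimes k}$ is represented by its array of entries, a function of
  \<open>k\<close> indices ranging over a finite type \<open>'n\<close>, where \<open>n = CARD('n)\<close>.
\<close>

type_synonym 'n tensor3 = "'n \<Rightarrow> 'n \<Rightarrow> 'n \<Rightarrow> real"
type_synonym 'n tensor4 = "'n \<Rightarrow> 'n \<Rightarrow> 'n \<Rightarrow> 'n \<Rightarrow> real"

definition symmetric_tensor3 :: "('n::finite) tensor3 \<Rightarrow> bool" where
  "symmetric_tensor3 T \<longleftrightarrow>
     (\<forall>a b c. T a b c = T a c b \<and> T a b c = T b a c \<and> T a b c = T b c a \<and>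
              T a b c = T c a b \<and> T a b c = T c b a)"

definition orthonormal_family :: "nat \<Rightarrow> (nat \<Rightarrow> real ^ 'n::finite) \<Rightarrow> bool" where
  "orthonormal_family r v \<longleftrightarrow>
     (\<forall>i\<in>{1..r}. \<forall>j\<in>{1..r}. v i \<bullet> v j = (if i = j then 1 else 0))"

definition symmetrically_odeco :: "('n::finite) tensor3 \<Rightarrow> bool" where
  "symmetrically_odeco T \<longleftrightarrow> symmetric_tensor3 T \<and>
     (\<exists>(r::nat) (lam :: nat \<Rightarrow> real) (v :: nat \<Rightarrow> real ^ 'n).
        orthonormal_family r v \<and>
        (\<forall>a b c. T a b c = (\<Sum>i=1..r. lam i * (v i $ a * v i $ b * v i $ c))))"

definition SOT2 :: "('n::finite) tensor4 set" where
  "SOT2 = {p. \<exists>T S. symmetrically_odeco T \<and> symmetrically_odeco S \<and>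
              (\<forall>a b c d. p a b c d = (\<Sum>s\<in>UNIV. T a b s * S s c d))}"

text \<open>
  A polynomial in the entries \<open>p a b c d\<close> is represented by the function on tensors that it
  defines; over the reals a polynomial is determined by this function. The condition
  \<open>\<sigma> permutes {a, b}\<close> makes \<open>\<sigma>\<close> a permutation of the set \<open>{a, b}\<close>, so only the identity is
  allowed when \<open>a = b\<close>.
\<close>

definition P_polys :: "(('n::finite) tensor4 \<Rightarrow> real) set" where
  "P_polys = {\<lambda>p. p a b c d - p (\<sigma>\<^sub>1 a) (\<sigma>\<^sub>1 b) (\<sigma>\<^sub>2 c) (\<sigma>\<^sub>2 d) | a b c d \<sigma>\<^sub>1 \<sigma>\<^sub>2.
                \<sigma>\<^sub>1 permutes {a, b} \<and> \<sigma>\<^sub>2 permutes {c, d}}"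

definition Q_polys :: "(('n::finite) tensor4 \<Rightarrow> real) set" where
  "Q_polys =
     {\<lambda>p. \<Sum>t\<in>UNIV. p a b e t * p c d f t - p a b f t * p c d e t | a b c d e f. True} \<union>
     {\<lambda>p. \<Sum>t\<in>UNIV. p e t a b * p f t c d - p f t a b * p e t c d | a b c d e f. True}"

end

theory Submission imports Defs begin

text \<open>
  If \<open>S = \<Sum>i. \<mu>\<^sub>i w\<^sub>i \<otimes> w\<^sub>i \<otimes> w\<^sub>i\<close> with orthonormal \<open>w\<^sub>i\<close>, then contracting two copies of
  \<open>S\<close> along one index gives \<open>\<Sum>i. \<mu>\<^sub>i\<^sup>2 w\<^sub>i \<otimes> w\<^sub>i \<otimes> w\<^sub>i \<otimes> w\<^sub>i\<close>, which is totally symmetric.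
  In the first kind of quadric the sum over \<open>t\<close> is such a contraction of \<open>S\<close>, so exchanging \<open>e\<close>
  and \<open>f\<close> does not change it. Reversing the tensor train exchanges the two kinds of quadrics.
\<close>

lemma odeco_contraction:
  fixes v :: "nat \<Rightarrow> real ^ 'n::finite"
  assumes v: "orthonormal_family r v"
    and S: "\<And>a b c. S a b c = (\<Sum>i=1..r. lam i * (v i $ a * v i $ b * v i $ c))"
  shows "(\<Sum>t\<in>UNIV. S a b t * S c d t) =
    (\<Sum>i=1..r. (lam i)\<^sup>2 * (v i $ a * v i $ b * v i $ c * v i $ d))"
proof -
  let ?x = "\<lambda>i. lam i * (v i $ a * v i $ b)"
  let ?y = "\<lambda>i. lam i * (v i $ c * v i $ d)"
  have "(\<Sum>t\<in>UNIV. S a b t * S c d t) =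
      (\<Sum>t\<in>UNIV. \<Sum>i=1..r. \<Sum>j=1..r. ?x i * ?y j * (v i $ t * v j $ t))"
    unfolding S sum_product by (simp add: mult_ac)
  also have "\<dots> = (\<Sum>i=1..r. \<Sum>j=1..r. \<Sum>t\<in>UNIV. ?x i * ?y j * (v i $ t * v j $ t))"
    by (subst sum.swap) (rule sum.cong[OF refl], rule sum.swap)
  \<comment> \<open>With the sum over \<open>t\<close> innermost, only
    \<open>v i $ t * v j $ t\<close> depends on \<open>t\<close>, so it sums to an inner product;
    orthonormality then kills the terms with \<open>i \<noteq> j\<close>.\<close>
  also have "\<dots> = (\<Sum>i=1..r. \<Sum>j=1..r. ?x i * ?y j * (v i \<bullet> v j))"
    by (simp add: inner_vec_def sum_distrib_left)
  also have "\<dots> = (\<Sum>i=1..r. \<Sum>j=1..r. if i = j then ?x i * ?y j else 0)"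
    using v by (intro sum.cong refl) (simp add: orthonormal_family_def)
  also have "\<dots> = (\<Sum>i=1..r. ?x i * ?y i)"
    by simp
  finally show ?thesis
    by (simp add: power2_eq_square mult_ac)
qed

lemma odeco_contraction_swap:
  fixes S :: "'n::finite tensor3"
  assumes "symmetrically_odeco S"
  shows "(\<Sum>t\<in>UNIV. S a e t * S c f t) = (\<Sum>t\<in>UNIV. S a f t * S c e t)"
proof -
  obtain r lam and v :: "nat \<Rightarrow> real ^ 'n" where "orthonormal_family r v"
    and "\<And>a b c. S a b c = (\<Sum>i=1..r. lam i * (v i $ a * v i $ b * v i $ c))"
    using assms unfolding symmetrically_odeco_def by blast
  from odeco_contraction[OF this] show ?thesis
    by (simp add: mult_ac)
qed

lemma SOT2_quadric:
  assumes "p \<in> SOT2"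
  shows "(\<Sum>t\<in>UNIV. p a b e t * p c d f t - p a b f t * p c d e t) = 0"
proof -
  obtain T S where S: "symmetrically_odeco S"
    and p: "\<And>a b c d. p a b c d = (\<Sum>s\<in>UNIV. T a b s * S s c d)"
    using assms unfolding SOT2_def by blast
  \<comment> \<open>The weights \<open>T a b s * T c d u\<close> are free of \<open>e\<close> and
    \<open>f\<close>, which enter only through the contraction of two copies of \<open>S\<close>.
    Generality in \<open>e f\<close> lets the same identity rewrite both halves of the
    difference.\<close>
  have expand: "(\<Sum>t\<in>UNIV. p a b e t * p c d f t) =
      (\<Sum>s\<in>UNIV. \<Sum>u\<in>UNIV. T a b s * T c d u * (\<Sum>t\<in>UNIV. S s e t * S u f t))" for e f
  proof -
    have "(\<Sum>t\<in>UNIV. p a b e t * p c d f t) =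
        (\<Sum>t\<in>UNIV. \<Sum>s\<in>UNIV. \<Sum>u\<in>UNIV. T a b s * T c d u * (S s e t * S u f t))"
      unfolding p sum_product by (simp add: mult_ac)
    also have "\<dots> = (\<Sum>s\<in>UNIV. \<Sum>u\<in>UNIV. \<Sum>t\<in>UNIV. T a b s * T c d u * (S s e t * S u f t))"
      by (subst sum.swap) (rule sum.cong[OF refl], rule sum.swap)
    finally show ?thesis
      by (simp add: sum_distrib_left)
  qed
  show ?thesis
    unfolding sum_subtractf expand using odeco_contraction_swap[OF S, of _ e _ f] by simp
qed

text \<open>Symmetry lets the index summed over move from the last slot to the first in
  \<open>T\<close> and from the first to the last in \<open>S\<close>, so the reversed tensor is the
  train of \<open>S\<close> followed by \<open>T\<close>.\<close>

lemma SOT2_reverse: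
  assumes "p \<in> SOT2"
  shows "(\<lambda>a b c d. p c d a b) \<in> SOT2"
proof -
  obtain T S where T: "symmetrically_odeco T" and S: "symmetrically_odeco S"
    and p: "\<And>a b c d. p a b c d = (\<Sum>s\<in>UNIV. T a b s * S s c d)"
    using assms unfolding SOT2_def by blast
  have "T c d s = T s c d" "S s a b = S a b s" for a b c d s
    using T S unfolding symmetrically_odeco_def symmetric_tensor3_def by metis+
  then have "p c d a b = (\<Sum>s\<in>UNIV. S a b s * T s c d)" for a b c d
    unfolding p by (intro sum.cong refl) (metis mult.commute)
  with T S show ?thesis
    unfolding SOT2_def by blast
qed

lemma SOT2_swap:
  assumes "p \<in> SOT2"
  shows "p b a c d = p a b c d" and "p a b d c = p a b c d"
proof -
  obtain T S where T: "symmetrically_odeco T" and S: "symmetrically_odeco S"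
    and p: "\<And>a b c d. p a b c d = (\<Sum>s\<in>UNIV. T a b s * S s c d)"
    using assms unfolding SOT2_def by blast
  have "T b a s = T a b s" "S s d c = S s c d" for s
    using T S unfolding symmetrically_odeco_def symmetric_tensor3_def by metis+
  then show "p b a c d = p a b c d" and "p a b d c = p a b c d"
    unfolding p by simp_all
qed

text \<open>An injective self-map of \<open>{a, b}\<close> fixes or exchanges the two; for
  \<open>a = b\<close> both alternatives say the same.\<close>

lemma permutes_doubleton_cases:
  assumes "\<sigma> permutes {a, b}"
  obtains "\<sigma> a = a" "\<sigma> b = b" | "\<sigma> a = b" "\<sigma> b = a"
  using permutes_in_image[OF assms, of a] permutes_in_image[OF assms, of b]
    permutes_inj[OF assms] by (auto dest: injD)

lemma SOT2_permute:
  assumes "p \<in> SOT2" and "\<sigma> permutes {a, b}" and "\<tau> permutes {c, d}"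
  shows "p (\<sigma> a) (\<sigma> b) (\<tau> c) (\<tau> d) = p a b c d"
  by (rule permutes_doubleton_cases[OF assms(2)]; rule permutes_doubleton_cases[OF assms(3)])
    (simp_all add: SOT2_swap[OF assms(1), of a b] SOT2_swap[OF assms(1), of _ _ c d])

theorem theorem6:
  fixes p :: "('n::finite) tensor4"
  assumes "CARD('n) \<ge> 2"
    and "p \<in> SOT2"
  shows "(\<forall>q \<in> P_polys \<union> Q_polys. q p = 0) \<and>
    (\<forall>a b c d \<sigma>\<^sub>1 \<sigma>\<^sub>2. \<sigma>\<^sub>1 permutes {a, b} \<longrightarrow> \<sigma>\<^sub>2 permutes {c, d} \<longrightarrow>
       p a b c d - p (\<sigma>\<^sub>1 a) (\<sigma>\<^sub>1 b) (\<sigma>\<^sub>2 c) (\<sigma>\<^sub>2 d) = 0) \<and>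
    (\<forall>a b c d e f.
       (\<Sum>t\<in>UNIV. p a b e t * p c d f t - p a b f t * p c d e t) = 0 \<and>
       (\<Sum>t\<in>UNIV. p e t a b * p f t c d - p f t a b * p e t c d) = 0)"
proof -
  \<comment> \<open>The first kind of quadric at the reversed tensor is, after beta reduction, the
    second kind at \<open>p\<close>.\<close>
  note quadrics = SOT2_quadric[OF assms(2)] SOT2_quadric[OF SOT2_reverse[OF assms(2)]]
  have "q p = 0" if "q \<in> P_polys \<union> Q_polys" for q
    using that unfolding P_polys_def Q_polys_def
    by (auto simp: SOT2_permute[OF assms(2)] quadrics)
  then show ?thesis
    by (simp add: SOT2_permute[OF assms(2)] quadrics)
qed

end
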